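(* Let $P$ be a program that terminates almost surely on a finite measure $\mu$ on $\mathbb{N}^n_\dagger$, i.e. $[\![P]\!]_\dagger(\mu)(\mathbb{N}^n_\dagger)=\mu(\mathbb{N}^n_\dagger)$. Then the residual mass $[\![P^{(u)}]\!]_{\mathsf{res}}(\mu)$ converges monotonically to $0$ as $u\to\infty$. In particular, if $\mu$ is a probability measure with $[\![P]\!]_\dagger(\mu)(\{\dagger\})<1$ and $S\subseteq\mathbb{N}^n$, then both $$\frac{[\![P^{(u)}]\!]_{\mathsf{lo}}(\mu)(S)}{1-[\![P^{(u)}]\!]_{\mathsf{lo}}(\mu)(\{\dagger\})}\quad\text{and}\quad\frac{[\![P^{(u)}]\!]_{\mathsf{lo}}(\mu)(S)+[\![P^{(u)}]\!]_{\mathsf{res}}(\mu)}{1-[\![P^{(u)}]\!]_{\mathsf{lo}}(\mu)(\{\dagger\})-[\![P^{(u)}]\!]_{\mathsf{res}}(\mu)}$$ converge to the true posterior probability $\mathrm{normalize}([\![P]\!]_\dagger(\mu))(S)$ as $u\to\infty$.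
   Context: Language. Fix $n$ variables $X_1,\dots,X_n$ with values in $\mathbb{N}=\{0,1,2,\dots\}$. Programs $P$ and events $E$ are given by $P ::= \mathsf{skip} \mid P_1;P_2 \mid X_k := 0 \mid X_k \mathrel{+}= a \mid X_k \mathrel{\dot-}= 1 \mid \mathsf{if}\ E\ \{P_1\}\ \mathsf{else}\ \{P_2\} \mid \mathsf{while}\ E\ \{P_1\} \mid \mathsf{fail}$ and $E ::= X_k = a \mid \mathsf{flip}(\rho) \mid \lnot E_1 \mid E_1 \land E_2$, with literals $a \in \mathbb{N}$, $\rho \in [0,1]$. State space. $\mathbb{N}^n_\dagger := \mathbb{N}^n \cup \{\dagger\}$ where $\dagger$ is a failure state; all $\sigma$-algebras are discrete. For measures, $\mu \preceq \nu$ means $\mu(S)\le\nu(S)$ for all $S$; for measure transformers, $\phi \sqsubseteq \psi$ means $\phi(\mu)\preceq\psi(\mu)$ for all $\mu$. Write $\mu|_\dagger$ and $\mu|_{\mathbb{N}^n}$ for the restrictions of $\mu$ to $\{\dagger\}$ and $\mathbb{N}^n$; $\boldsymbol{x}[k\mapsto v]$ is $\boldsymbol{x}$ with $k$-th entry replaced by $v$; $x \mathbin{\dot-} 1 := \max(x-1,0)$. Event semantics. $\mu|_{X_k=a}(S) := \mu(\{\boldsymbol{x}\in S\cap\mathbb{N}^n : x_k=a\})$, $\mu|_{\mathsf{flip}(\rho)} := \rho\cdot\mu|_{\mathbb{N}^n}$, $\mu|_{\lnot E_1} := \mu|_{\mathbb{N}^n}-\mu|_{E_1}$, $\mu|_{E_1\land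 E_2} := (\mu|_{E_1})|_{E_2}$. Standard semantics $[\![P]\!]_\dagger : \mathrm{Meas}(\mathbb{N}^n_\dagger)\to\mathrm{Meas}(\mathbb{N}^n_\dagger)$: $[\![\mathsf{skip}]\!]_\dagger(\mu)=\mu$; $[\![P_1;P_2]\!]_\dagger(\mu)=[\![P_2]\!]_\dagger([\![P_1]\!]_\dagger(\mu))$; $[\![X_k:=0]\!]_\dagger(\mu)(S)=\mu|_\dagger(S)+\mu(\{\boldsymbol{x}\in\mathbb{N}^n : \boldsymbol{x}[k\mapsto 0]\in S\})$; $[\![X_k \mathrel{+}= a]\!]_\dagger(\mu)(S)=\mu|_\dagger(S)+\mu(\{\boldsymbol{x}\in\mathbb{N}^n : \boldsymbol{x}[k\mapsto x_k+a]\in S\})$; $[\![X_k \mathrel{\dot-}= 1]\!]_\dagger(\mu)(S)=\mu|_\dagger(S)+\mu(\{\boldsymbol{x}\in\mathbb{N}^n : \boldsymbol{x}[k\mapsto x_k\mathbin{\dot-}1]\in S\})$; $[\![\mathsf{if}\ E\ \{P_1\}\ \mathsf{else}\ \{P_2\}]\!]_\dagger(\mu)=\mu|_\dagger+[\![P_1]\!]_\dagger(\mu|_E)+[\![P_2]\!]_\dagger(\mu|_{\lnot E})$; $[\![\mathsf{fail}]\!]_\dagger(\mu)=\mu(\mathbb{N}^n_\dagger)\cdot\mathrm{Dirac}(\dagger)$; $[\![\mathsf{while}\ E\ \{P_1\}]\!]_\dagger$ is the least fixed point (w.r.t. $\sqsubseteq$) of $\Phi_{E,P_1}(\psi)(\mu)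 := \mu|_\dagger+\mu|_{\lnot E}+\psi([\![P_1]\!]_\dagger(\mu|_E))$. Unrolling. For $u\in\mathbb{N}$ the $u$-fold unrolling $P^{(u)}$ of $P$ is: $(P_1;P_2)^{(u)} := P_1^{(u)};P_2^{(u)}$; $(\mathsf{if}\ E\ \{P_1\}\ \mathsf{else}\ \{P_2\})^{(u)} := \mathsf{if}\ E\ \{P_1^{(u)}\}\ \mathsf{else}\ \{P_2^{(u)}\}$; $(\mathsf{while}\ E\ \{P\})^{(u)} := (\mathsf{while}\ E\ \{P\})^{(u)}_0$, where $(\mathsf{while}\ E\ \{P\})^{(u)}_v := \mathsf{if}\ E\ \{P^{(u)};(\mathsf{while}\ E\ \{P\})^{(u)}_{v+1}\}\ \mathsf{else}\ \{\mathsf{skip}\}$ for $v<u$ and $(\mathsf{while}\ E\ \{P\})^{(u)}_u := \mathsf{while}\ E\ \{P^{(u)}\}$; and $P^{(u)} := P$ for all other programs. Lower bound semantics. $[\![P]\!]_{\mathsf{lo}}$ is defined by the same recursive clauses as $[\![P]\!]_\dagger$ except that $[\![\mathsf{while}\ E\ \{P_1\}]\!]_{\mathsf{lo}}(\mu) := 0$ (the zero measure). Residual mass. $[\![P]\!]_{\mathsf{res}}(\mu) := \mu(\mathbb{N}^n_\dagger)-[\![P]\!]_{\mathsf{lo}}(\mu)(\mathbb{N}^n_\dagger)$ for finite $\mu$. Normalization. For a subprobability measure $\nu$ on $\mathbb{N}^n_\dagger$ with $\nu(\{\dagger\})<1$, $\mathrm{normalize}(\nu) := \dfrac{\nu-\nu|_\dagger}{1-\nu(\{\dagger\})}$,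 a measure on $\mathbb{N}^n$. *)

theory Defs
  imports "HOL-Probability.Probability"
begin

section \<open>Syntax\<close>

text \<open>The variables are indexed by an arbitrary type \<open>'n\<close>, which the theorem takes to be finite.\<close>

typedef unit_real = "{0..1::real}"
  by (rule exI[of _ 0]) simp

datatype 'n event =
    VarEq 'n nat
  | Flip unit_real
  | Neg "'n event"
  | Conj "'n event" "'n event"

datatype 'n prog =
    Skip
  | Seq "'n prog" "'n prog"
  | Reset 'n
  | Incr 'n nat
  | Decr 'n
  | Cond "'n event" "'n prog" "'n prog"
  | While "'n event" "'n prog"
  | Fail

section \<open>States and measures\<close>

type_synonym 'n state = "('n \<Rightarrow> nat) option"

abbreviation dagger :: "'n state" ("\<dagger>") where
  "\<dagger> \<equiv> None"

abbreviation proper :: "'n state set" where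
  "proper \<equiv> range Some"

text \<open>Measures on the discrete \<open>\<sigma>\<close>-algebra; \<open>sets \<mu> = UNIV\<close> forces \<open>space \<mu> = UNIV\<close>. Between two such
  measures the library order \<open>\<mu> \<le> \<nu>\<close> is the setwise one.\<close>

definition Meas :: "'n state measure set" where
  "Meas = {\<mu>. sets \<mu> = UNIV}"

definition add_measure :: "'a measure \<Rightarrow> 'a measure \<Rightarrow> 'a measure" where
  "add_measure \<mu> \<nu> = measure_of (space \<mu>) (sets \<mu>) (\<lambda>S. emeasure \<mu> S + emeasure \<nu> S)"

text \<open>\<open>restr \<mu> A\<close> is \<open>S \<mapsto> \<mu> (S \<inter> A)\<close>, still a measure on the whole space.\<close>

definition restr :: "'a measure \<Rightarrow> 'a set \<Rightarrow> 'a measure" where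
  "restr \<mu> A = density \<mu> (indicator A)"

definition push :: "(('n \<Rightarrow> nat) \<Rightarrow> ('n \<Rightarrow> nat)) \<Rightarrow> 'n state measure \<Rightarrow> 'n state measure" where
  "push f \<mu> = distr \<mu> (count_space UNIV) (map_option f)"

section \<open>Semantics\<close>

text \<open>The difference in the clause for \<open>Neg\<close> is the setwise one when \<open>\<mu>\<close> is finite. On infinite measures,
  where it may involve \<open>\<infinity> - \<infinity>\<close>, its value is a mere convention.\<close>

primrec event_sem :: "'n event \<Rightarrow> 'n state measure \<Rightarrow> 'n state measure" where
  "event_sem (VarEq k a) \<mu> = restr \<mu> {Some x | x. x k = a}"
| "event_sem (Flip \<rho>) \<mu> = scale_measure (ennreal (Rep_unit_real \<rho>)) (restr \<mu> proper)"
| "event_sem (Neg E) \<mu> = diff_measure (restr \<mu> proper) (event_sem E \<mu>)"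
| "event_sem (Conj E1 E2) \<mu> = event_sem E2 (event_sem E1 \<mu>)"

text \<open>The two semantics differ only in the clause for loops, so they share one recursion over a
  parameter \<open>W\<close>: the transformer of a loop as a function of its guard and of the transformer of its body.\<close>

primrec sem_with ::
  "('n event \<Rightarrow> ('n state measure \<Rightarrow> 'n state measure) \<Rightarrow> 'n state measure \<Rightarrow> 'n state measure) \<Rightarrow>
   'n prog \<Rightarrow> 'n state measure \<Rightarrow> 'n state measure"
where
  "sem_with W Skip = (\<lambda>\<mu>. \<mu>)"
| "sem_with W (Seq P1 P2) = (\<lambda>\<mu>. sem_with W P2 (sem_with W P1 \<mu>))"
| "sem_with W (Reset k) = push (\<lambda>x. x(k := 0))"
| "sem_with W (Incr k a) = push (\<lambda>x. x(k := x k + a))"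
| "sem_with W (Decr k) = push (\<lambda>x. x(k := x k - 1))"
| "sem_with W (Cond E P1 P2) = (\<lambda>\<mu>. add_measure (restr \<mu> {\<dagger>})
     (add_measure (sem_with W P1 (event_sem E \<mu>)) (sem_with W P2 (event_sem (Neg E) \<mu>))))"
| "sem_with W (While E P) = W E (sem_with W P)"
| "sem_with W Fail = (\<lambda>\<mu>. scale_measure (emeasure \<mu> UNIV) (return (count_space UNIV) \<dagger>))"

definition loop_functional ::
  "'n event \<Rightarrow> ('n state measure \<Rightarrow> 'n state measure) \<Rightarrow>
   ('n state measure \<Rightarrow> 'n state measure) \<Rightarrow> ('n state measure \<Rightarrow> 'n state measure)"
where
  "loop_functional E \<phi> \<psi> \<mu> =
     add_measure (restr \<mu> {\<dagger>}) (add_measure (event_sem (Neg E) \<mu>) (\<psi> (\<phi> (event_sem E \<mu>))))"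

text \<open>Least fixed point among the transformers from \<open>Meas\<close> to \<open>Meas\<close>. Restricting to extensional
  functions makes the pointwise order of the function type the pointwise order on \<open>Meas\<close>.\<close>

definition loop_lfp ::
  "'n event \<Rightarrow> ('n state measure \<Rightarrow> 'n state measure) \<Rightarrow> 'n state measure \<Rightarrow> 'n state measure"
where
  "loop_lfp E \<phi> = (LEAST \<psi>. \<psi> \<in> Meas \<rightarrow>\<^sub>E Meas \<and> (\<forall>\<mu>\<in>Meas. loop_functional E \<phi> \<psi> \<mu> = \<psi> \<mu>))"

definition sem :: "'n prog \<Rightarrow> 'n state measure \<Rightarrow> 'n state measure" where
  "sem = sem_with loop_lfp"

definition sem_lo :: "'n prog \<Rightarrow> 'n state measure \<Rightarrow> 'n state measure" where
  "sem_lo = sem_with (\<lambda>E \<phi> \<mu>. null_measure \<mu>)"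

definition residual :: "'n prog \<Rightarrow> 'n state measure \<Rightarrow> real" where
  "residual P \<mu> = measure \<mu> UNIV - measure (sem_lo P \<mu>) UNIV"

text \<open>A measure on the subspace \<open>proper\<close>, i.e. with \<open>space (normalize_sub \<nu>) = proper\<close>.\<close>

definition normalize_sub :: "'n state measure \<Rightarrow> 'n state measure" where
  "normalize_sub \<nu> = restrict_space
     (scale_measure (1 / (1 - emeasure \<nu> {\<dagger>})) (diff_measure \<nu> (restr \<nu> {\<dagger>}))) proper"

definition terminates_as :: "'n prog \<Rightarrow> 'n state measure \<Rightarrow> bool" where
  "terminates_as P \<mu> \<longleftrightarrow> emeasure (sem P \<mu>) UNIV = emeasure \<mu> UNIV"

section \<open>Unrolling\<close>

text \<open>\<open>unroll_loop E Q m\<close> is the loop with guard \<open>E\<close> and already unrolled body \<open>Q\<close> when \<open>m = u - v\<close>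
  unrollings remain, where \<open>v\<close> counts up from \<open>0\<close> to \<open>u\<close>.\<close>

primrec unroll_loop :: "'n event \<Rightarrow> 'n prog \<Rightarrow> nat \<Rightarrow> 'n prog" where
  "unroll_loop E Q 0 = While E Q"
| "unroll_loop E Q (Suc m) = Cond E (Seq Q (unroll_loop E Q m)) Skip"

primrec unroll :: "nat \<Rightarrow> 'n prog \<Rightarrow> 'n prog" where
  "unroll u Skip = Skip"
| "unroll u (Seq P1 P2) = Seq (unroll u P1) (unroll u P2)"
| "unroll u (Reset k) = Reset k"
| "unroll u (Incr k a) = Incr k a"
| "unroll u (Decr k) = Decr k"
| "unroll u (Cond E P1 P2) = Cond E (unroll u P1) (unroll u P2)"
| "unroll u (While E P) = unroll_loop E (unroll u P) u"
| "unroll u Fail = Fail"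

section \<open>Setwise formulas\<close>

lemma emeasure_add_measure:
  fixes \<mu> \<nu> :: "'a measure"
  assumes "sets \<mu> = UNIV" "sets \<nu> = UNIV"
  shows "emeasure (add_measure \<mu> \<nu>) S = emeasure \<mu> S + emeasure \<nu> S"
proof -
  have sp: "space \<mu> = UNIV" using assms(1) by (metis UNIV_I sets.sets_into_space top.extremum_uniqueI)
  show ?thesis
  proof (rule emeasure_measure_of[OF add_measure_def])
    show "countably_additive (sets (add_measure \<mu> \<nu>)) (\<lambda>S. emeasure \<mu> S + emeasure \<nu> S)"
    proof (rule countably_additiveI)
      fix A :: "nat \<Rightarrow> 'a set" assume d: "disjoint_family A"
      have "(\<Sum>i. emeasure \<mu> (A i) + emeasure \<nu> (A i)) = (\<Sum>i. emeasure \<mu> (A i)) + (\<Sum>i. emeasure \<nu> (A i))"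
        by (intro suminf_add[symmetric]) auto
      then show "(\<Sum>i. emeasure \<mu> (A i) + emeasure \<nu> (A i)) = emeasure \<mu> (\<Union>i. A i) + emeasure \<nu> (\<Union>i. A i)"
        using d assms by (simp add: suminf_emeasure)
    qed
  qed (use assms sp in \<open>auto simp: positive_def add_measure_def\<close>)
qed

lemma emeasure_restr:
  assumes "sets \<mu> = UNIV"
  shows "emeasure (restr \<mu> A) S = emeasure \<mu> (S \<inter> A)"
  unfolding restr_def using assms by (subst emeasure_restricted) (auto simp: Int_commute)

lemma emeasure_push:
  assumes "sets \<mu> = UNIV"
  shows "emeasure (push f \<mu>) S = emeasure (restr \<mu> {\<dagger>}) S + emeasure \<mu> {Some x | x. Some (f x) \<in> S}"
proof -
  have sp: "space \<mu> = UNIV" using assms by (metis UNIV_I sets.sets_into_space top.extremum_uniqueI)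
  have "emeasure (push f \<mu>) S = emeasure \<mu> (map_option f -` S)"
    unfolding push_def using sp assms by (subst emeasure_distr) (auto simp: measurable_def)
  also have "map_option f -` S = (S \<inter> {\<dagger>}) \<union> {Some x | x. Some (f x) \<in> S}"
    by (auto simp: map_option_case split: option.splits)
  also have "emeasure \<mu> \<dots> = emeasure \<mu> (S \<inter> {\<dagger>}) + emeasure \<mu> {Some x | x. Some (f x) \<in> S}"
    by (rule plus_emeasure[symmetric]) (use assms in auto)
  finally show ?thesis by (simp add: emeasure_restr assms)
qed

end

theory Submission
  imports Defs
begin

text \<open>Say that measures \<open>M u\<close> increase to a finite measure \<open>\<mu>\<close> if they do so setwise. By induction on
  \<open>P\<close>, the lower bound semantics of the unrollings of \<open>P\<close>, applied to measures increasing to \<open>\<mu>\<close>,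
  increase to the standard semantics of \<open>P\<close> applied to \<open>\<mu>\<close>; letting the input vary with \<open>u\<close> makes
  sequential composition immediate. For a loop with guard \<open>E\<close> and body semantics \<open>\<phi>\<close>, put
  \<open>T \<mu> = \<phi> (\<mu>|E)\<close> and \<open>g \<mu> = \<mu>|\<dagger> + \<mu>|\<not>E\<close>. The least fixed point is \<open>\<Sum>n. g (T\<^sup>n \<mu>)\<close>, and the \<open>u\<close>-fold
  unrolling cuts this series after \<open>u\<close> terms. Almost sure termination then says precisely that the
  residual mass tends to \<open>0\<close>.\<close>

section \<open>Measures on the discrete \<open>\<sigma>\<close>-algebra\<close>

lemma space_UNIV: "sets \<mu> = UNIV \<Longrightarrow> space \<mu> = UNIV"
  by (metis UNIV_I sets.sets_into_space top.extremum_uniqueI)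

lemma sets_add_measure [simp]: "sets (add_measure \<mu> \<nu>) = sets \<mu>"
  by (simp add: add_measure_def)

lemma sets_restr [simp]: "sets (restr \<mu> A) = sets \<mu>"
  by (simp add: restr_def)

lemma sets_push [simp]: "sets (push f \<mu>) = UNIV"
  by (simp add: push_def)

lemma sets_event_sem [simp]: "sets (event_sem E \<mu>) = sets \<mu>"
  by (induction E arbitrary: \<mu>) simp_all

lemma finite_measure_UNIV_I: "emeasure \<mu> UNIV < \<infinity> \<Longrightarrow> sets \<mu> = UNIV \<Longrightarrow> finite_measure \<mu>"
  by (rule finite_measureI) (auto simp: space_UNIV)

lemma finite_measure_dominated:
  assumes "finite_measure \<mu>" "sets \<nu> = UNIV" "sets \<mu> = UNIV" "emeasure \<nu> UNIV \<le> emeasure \<mu> UNIV"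
  shows "finite_measure \<nu>"
  using assms finite_measure.emeasure_finite[of \<mu> UNIV]
  by (intro finite_measure_UNIV_I) (auto simp: less_top top_unique)

lemma finite_measure_restr:
  "finite_measure \<mu> \<Longrightarrow> sets \<mu> = UNIV \<Longrightarrow> finite_measure (restr \<mu> A)"
  by (erule finite_measure_dominated) (auto simp: emeasure_restr intro: emeasure_mono)

section \<open>Countable sums of measures\<close>

definition sum_measure :: "(nat \<Rightarrow> 'a measure) \<Rightarrow> 'a measure" where
  "sum_measure M = measure_of UNIV UNIV (\<lambda>S. \<Sum>n. emeasure (M n) S)"

lemma sets_sum_measure [simp]: "sets (sum_measure M) = UNIV"
  unfolding sum_measure_def using sets.sets_measure_of_eq[of "count_space UNIV"] by simp

text \<open>Countable additivity amounts to exchanging two series of extended nonnegative numbers.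
  The sum over \<open>n\<close> is read as an integral over the counting measure, which commutes
  with series of nonnegative functions.\<close>

lemma emeasure_sum_measure:
  fixes M :: "nat \<Rightarrow> 'a measure"
  assumes "\<And>n. sets (M n) = UNIV"
  shows "emeasure (sum_measure M) S = (\<Sum>n. emeasure (M n) S)"
proof (rule emeasure_measure_of[OF sum_measure_def])
  show "countably_additive (sets (sum_measure M)) (\<lambda>S. \<Sum>n. emeasure (M n) S)"
  proof (rule countably_additiveI)
    fix A :: "nat \<Rightarrow> 'a set" assume d: "disjoint_family A"
    have "(\<Sum>i. \<Sum>n. emeasure (M n) (A i)) = (\<Sum>i. \<integral>\<^sup>+n. emeasure (M n) (A i) \<partial>count_space UNIV)"
      by (simp add: nn_integral_count_space_nat)
    also have "\<dots> = (\<integral>\<^sup>+n. (\<Sum>i. emeasure (M n) (A i)) \<partial>count_space UNIV)"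
      by (rule nn_integral_suminf[symmetric]) simp
    also have "\<dots> = (\<Sum>n. emeasure (M n) (\<Union>i. A i))"
      using d assms by (simp add: nn_integral_count_space_nat suminf_emeasure)
    finally show "(\<Sum>i. \<Sum>n. emeasure (M n) (A i)) = (\<Sum>n. emeasure (M n) (\<Union>i. A i))" .
  qed
qed (auto simp: positive_def)

section \<open>Events\<close>

text \<open>An event only thins out the proper part of a measure. Taken on \<open>UNIV\<close>, the
  bound also yields finiteness of the intermediate measures. The induction needs this: the
  difference in \<open>Neg\<close> is then setwise, and in \<open>Conj\<close> the hypothesis for
  \<open>E2\<close> applies to the output of \<open>E1\<close>.\<close>

lemma emeasure_event_sem_le:
  assumes "finite_measure \<mu>" "sets \<mu> = UNIV"
  shows "finite_measure (event_sem E \<mu>) \<and> emeasure (event_sem E \<mu>) S \<le> emeasure \<mu> (S \<inter> proper)"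
proof -
  have *: "emeasure (event_sem E \<mu>) S \<le> emeasure \<mu> (S \<inter> proper)" for S
    using assms
  proof (induction E arbitrary: \<mu> S)
    case (VarEq k a)
    then show ?case by (auto simp: emeasure_restr intro!: emeasure_mono)
  next
    case (Flip r)
    have "ennreal (Rep_unit_real r) \<le> 1" using Rep_unit_real[of r] by auto
    from mult_right_mono[OF this, of "emeasure \<mu> (S \<inter> proper)"] Flip show ?case
      by (simp add: emeasure_restr)
  next
    case (Neg E)
    have fin: "finite_measure (event_sem E \<mu>)"
      using Neg by (intro finite_measure_dominated[OF Neg.prems(1)])
        (auto intro!: order_trans[OF Neg.IH] emeasure_mono)
    show ?case
      using Neg fin
      by (simp, subst emeasure_diff_measure) (auto simp: emeasure_restr intro: finite_measure_restr)
  next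
    case (Conj E1 E2)
    have fin: "finite_measure (event_sem E1 \<mu>)"
      using Conj by (intro finite_measure_dominated[OF Conj.prems(1)])
        (auto intro!: order_trans[OF Conj.IH(1)] emeasure_mono)
    have "emeasure (event_sem E2 (event_sem E1 \<mu>)) S \<le> emeasure (event_sem E1 \<mu>) (S \<inter> proper)"
      using fin Conj by simp
    also have "\<dots> \<le> emeasure \<mu> (S \<inter> proper \<inter> proper)" using Conj by blast
    finally show ?case by (simp add: Int_assoc)
  qed
  have "emeasure \<mu> (UNIV \<inter> proper) \<le> emeasure \<mu> UNIV" by (rule emeasure_mono) (use assms in auto)
  then have "emeasure (event_sem E \<mu>) UNIV \<le> emeasure \<mu> UNIV"
    using *[of UNIV] by (meson order_trans)
  then have "finite_measure (event_sem E \<mu>)"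
    using assms by (intro finite_measure_dominated[OF assms(1)]) simp_all
  then show ?thesis using *[of S] ..
qed

lemmas finite_measure_event_sem = emeasure_event_sem_le[THEN conjunct1]

lemma emeasure_event_sem_Neg:
  assumes "finite_measure \<mu>" "sets \<mu> = UNIV"
  shows "emeasure (event_sem (Neg E) \<mu>) S = emeasure \<mu> (S \<inter> proper) - emeasure (event_sem E \<mu>) S"
  using assms emeasure_event_sem_le[OF assms]
  by (simp, subst emeasure_diff_measure) (auto simp: emeasure_restr intro: finite_measure_restr)

text \<open>The preceding bound, applied to \<open>S - proper\<close>, leaves no mass on the failure
  state.\<close>

lemma emeasure_event_sem_proper:
  assumes "finite_measure \<mu>" "sets \<mu> = UNIV"
  shows "emeasure (event_sem E \<mu>) (S \<inter> proper) = emeasure (event_sem E \<mu>) S"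
proof -
  have "emeasure (event_sem E \<mu>) (S - proper) = 0"
    using emeasure_event_sem_le[OF assms, of E "S - proper"] by (simp add: Int_commute)
  moreover have "emeasure (event_sem E \<mu>) (S \<inter> proper) + emeasure (event_sem E \<mu>) (S - proper)
    = emeasure (event_sem E \<mu>) ((S \<inter> proper) \<union> (S - proper))"
    by (rule plus_emeasure) (use assms in auto)
  ultimately show ?thesis by (simp add: Int_Diff_Un)
qed

lemma emeasure_event_split:
  assumes "finite_measure \<mu>" "sets \<mu> = UNIV"
  shows "emeasure (event_sem E \<mu>) S + emeasure (event_sem (Neg E) \<mu>) S = emeasure \<mu> (S \<inter> proper)"
  using emeasure_event_sem_le[OF assms, of E S]
  by (simp add: emeasure_event_sem_Neg assms add_diff_self_ennreal del: event_sem.simps)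

text \<open>From here on four lemmas push a negation down to the atoms, so that subtraction
  disappears from the semantics of events. The convergence argument needs such positive forms,
  because the difference of two increasing sequences need not increase.\<close>

lemma event_sem_Neg_VarEq:
  assumes "finite_measure \<mu>" "sets \<mu> = UNIV"
  shows "event_sem (Neg (VarEq k a)) \<mu> = restr \<mu> {Some x | x. x k \<noteq> a}"
proof (rule measure_eqI)
  fix S
  interpret finite_measure \<mu> by fact
  have "emeasure (event_sem (Neg (VarEq k a)) \<mu>) S
      = emeasure \<mu> (S \<inter> proper) - emeasure \<mu> (S \<inter> {Some x | x. x k = a})"
    by (subst emeasure_event_sem_Neg[OF assms]) (simp add: emeasure_restr assms)
  also have "\<dots> = emeasure \<mu> (S \<inter> proper - S \<inter> {Some x | x. x k = a})"
    using assms by (intro emeasure_Diff[symmetric]) auto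
  also have "S \<inter> proper - S \<inter> {Some x | x. x k = a} = S \<inter> {Some x | x. x k \<noteq> a}" by auto
  finally show "emeasure (event_sem (Neg (VarEq k a)) \<mu>) S
      = emeasure (restr \<mu> {Some x | x. x k \<noteq> a}) S"
    by (simp add: emeasure_restr assms)
qed simp

lemma event_sem_Neg_Flip:
  assumes "finite_measure \<mu>" "sets \<mu> = UNIV"
  shows "event_sem (Neg (Flip r)) \<mu>
    = scale_measure (ennreal (1 - Rep_unit_real r)) (restr \<mu> proper)"
proof (rule measure_eqI)
  fix S
  interpret finite_measure \<mu> by fact
  have r: "0 \<le> Rep_unit_real r" "Rep_unit_real r \<le> 1" using Rep_unit_real[of r] by auto
  have "emeasure (event_sem (Neg (Flip r)) \<mu>) S
      = emeasure \<mu> (S \<inter> proper) - ennreal (Rep_unit_real r) * emeasure \<mu> (S \<inter> proper)"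
    by (subst emeasure_event_sem_Neg[OF assms]) (simp add: emeasure_restr assms)
  also have "\<dots> = ennreal (1 - Rep_unit_real r) * emeasure \<mu> (S \<inter> proper)"
    using r by (simp add: emeasure_eq_measure ennreal_minus ennreal_mult[symmetric] algebra_simps)
  finally show "emeasure (event_sem (Neg (Flip r)) \<mu>) S
      = emeasure (scale_measure (ennreal (1 - Rep_unit_real r)) (restr \<mu> proper)) S"
    by (simp add: emeasure_restr assms)
qed simp

lemma event_sem_Neg_Neg:
  assumes "finite_measure \<mu>" "sets \<mu> = UNIV"
  shows "event_sem (Neg (Neg E)) \<mu> = event_sem E \<mu>"
proof (rule measure_eqI)
  fix S
  interpret finite_measure \<mu> by fact
  show "emeasure (event_sem (Neg (Neg E)) \<mu>) S = emeasure (event_sem E \<mu>) S"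
    using emeasure_event_sem_le[OF assms, of E S]
    by (simp add: emeasure_event_sem_Neg assms diff_diff_ennreal del: event_sem.simps)
qed simp

text \<open>A conjunction fails either because \<open>E1\<close> fails, or because \<open>E1\<close>
  holds and then \<open>E2\<close> fails. With \<open>\<nu>\<close> the part of \<open>\<mu>\<close>
  on which \<open>E1\<close> holds, this is the telescoping of \<open>\<mu> - \<nu>|E2\<close>
  through \<open>\<nu>\<close>; the inequalities \<open>1\<close> and \<open>2\<close> ensure that
  no difference is truncated.\<close>

lemma event_sem_Neg_Conj:
  assumes "finite_measure \<mu>" "sets \<mu> = UNIV"
  shows "event_sem (Neg (Conj E1 E2)) \<mu>
    = add_measure (event_sem (Neg E1) \<mu>) (event_sem (Neg E2) (event_sem E1 \<mu>))"
proof (rule measure_eqI)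
  fix S
  interpret finite_measure \<mu> by fact
  define \<nu> where "\<nu> = event_sem E1 \<mu>"
  have \<nu>: "finite_measure \<nu>" "sets \<nu> = UNIV"
    using assms by (auto simp: \<nu>_def finite_measure_event_sem)
  interpret \<nu>: finite_measure \<nu> by fact
  have 1: "emeasure \<nu> S \<le> emeasure \<mu> (S \<inter> proper)"
    using emeasure_event_sem_le[OF assms] by (simp add: \<nu>_def)
  have 2: "emeasure (event_sem E2 \<nu>) S \<le> emeasure \<nu> S"
    using emeasure_event_sem_le[OF \<nu>, of E2 S] emeasure_event_sem_proper[OF assms, of E1 S]
    by (simp add: \<nu>_def)
  have "emeasure (event_sem (Neg (Conj E1 E2)) \<mu>) S
      = emeasure \<mu> (S \<inter> proper) - emeasure (event_sem E2 \<nu>) S"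
    by (subst emeasure_event_sem_Neg[OF assms]) (simp add: \<nu>_def)
  also have "\<dots> = (emeasure \<mu> (S \<inter> proper) - emeasure \<nu> S)
      + (emeasure \<nu> S - emeasure (event_sem E2 \<nu>) S)"
    using 1 2 \<nu>.emeasure_finite[of S]
    by (cases "emeasure \<mu> (S \<inter> proper)"; cases "emeasure \<nu> S"; cases "emeasure (event_sem E2 \<nu>) S")
      (auto simp: ennreal_minus top_unique simp flip: ennreal_plus)
  also have "\<dots> = emeasure (event_sem (Neg E1) \<mu>) S + emeasure (event_sem (Neg E2) \<nu>) S"
    using emeasure_event_sem_proper[OF assms, of E1 S]
    by (simp add: emeasure_event_sem_Neg assms \<nu> del: event_sem.simps) (simp add: \<nu>_def)
  finally show "emeasure (event_sem (Neg (Conj E1 E2)) \<mu>) S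
      = emeasure (add_measure (event_sem (Neg E1) \<mu>) (event_sem (Neg E2) (event_sem E1 \<mu>))) S"
    by (subst emeasure_add_measure) (auto simp: assms \<nu>_def simp del: event_sem.simps)
qed simp

section \<open>Loops\<close>

text \<open>This is the map \<open>g\<close> of the overview, and \<open>loop_step\<close> is
  \<open>T\<close>. Failure mass counts as having left the loop: events discard it, so failure that
  arises in the body is collected by \<open>g\<close> in the next round.\<close>

definition loop_exit :: "'n event \<Rightarrow> 'n state measure \<Rightarrow> 'n state measure" where
  "loop_exit E \<mu> = add_measure (restr \<mu> {\<dagger>}) (event_sem (Neg E) \<mu>)"

definition loop_step ::
  "'n event \<Rightarrow> ('n state measure \<Rightarrow> 'n state measure) \<Rightarrow> 'n state measure \<Rightarrow> 'n state measure" where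
  "loop_step E \<phi> \<mu> = \<phi> (event_sem E \<mu>)"

definition loop_sum ::
  "'n event \<Rightarrow> ('n state measure \<Rightarrow> 'n state measure) \<Rightarrow> 'n state measure \<Rightarrow> 'n state measure" where
  "loop_sum E \<phi> \<mu> = sum_measure (\<lambda>n. loop_exit E ((loop_step E \<phi> ^^ n) \<mu>))"

section \<open>Setwise formulas for the loop series\<close>

lemma sets_loop_exit [simp]: "sets (loop_exit E \<mu>) = sets \<mu>"
  by (simp add: loop_exit_def)

lemma sets_loop_sum [simp]: "sets (loop_sum E \<phi> \<mu>) = UNIV"
  by (simp add: loop_sum_def)

lemma emeasure_loop_exit:
  "sets \<mu> = UNIV \<Longrightarrow> emeasure (loop_exit E \<mu>) S
    = emeasure \<mu> (S \<inter> {\<dagger>}) + emeasure (event_sem (Neg E) \<mu>) S"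
  by (simp add: loop_exit_def emeasure_add_measure emeasure_restr del: event_sem.simps)

lemma loop_step_funpow_Meas:
  assumes "\<phi> \<in> Meas \<rightarrow> Meas" "\<mu> \<in> Meas"
  shows "(loop_step E \<phi> ^^ n) \<mu> \<in> Meas"
  using assms by (induction n) (auto simp: loop_step_def Meas_def)

lemma emeasure_loop_sum:
  assumes "\<phi> \<in> Meas \<rightarrow> Meas" "\<mu> \<in> Meas"
  shows "emeasure (loop_sum E \<phi> \<mu>) S = (\<Sum>n. emeasure (loop_exit E ((loop_step E \<phi> ^^ n) \<mu>)) S)"
  unfolding loop_sum_def using loop_step_funpow_Meas[OF assms]
  by (intro emeasure_sum_measure) (simp add: Meas_def)

lemma emeasure_loop_functional:
  assumes "\<phi> \<in> Meas \<rightarrow> Meas" "\<psi> \<in> Meas \<rightarrow> Meas" "\<mu> \<in> Meas"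
  shows "emeasure (loop_functional E \<phi> \<psi> \<mu>) S
    = emeasure (loop_exit E \<mu>) S + emeasure (\<psi> (loop_step E \<phi> \<mu>)) S"
proof -
  have "event_sem E \<mu> \<in> Meas" using assms(3) by (simp add: Meas_def)
  then have "\<psi> (\<phi> (event_sem E \<mu>)) \<in> Meas" using assms by blast
  then show ?thesis using assms(3)
    by (simp add: loop_functional_def emeasure_add_measure emeasure_loop_exit loop_step_def Meas_def
        emeasure_restr add.assoc del: event_sem.simps)
qed

text \<open>The series solves the fixed point equation because splitting off its term for
  \<open>n = 0\<close> leaves the series started at \<open>T \<mu>\<close>. It lies below any
  solution \<open>\<psi>\<close> because unfolding the equation \<open>N\<close> times writes
  \<open>\<psi> \<mu>\<close> as the first \<open>N\<close> terms plus the remainder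
  \<open>\<psi> (T^N \<mu>)\<close>, which may be dropped.\<close>

lemma loop_lfp_eq:
  fixes E :: "'n event"
  assumes \<phi>: "\<phi> \<in> Meas \<rightarrow> Meas"
  shows "loop_lfp E \<phi> = restrict (loop_sum E \<phi>) Meas"
  unfolding loop_lfp_def
proof (rule Least_equality)
  let ?T = "loop_step E \<phi>"
  have "loop_functional E \<phi> (restrict (loop_sum E \<phi>) Meas) \<mu> = loop_sum E \<phi> \<mu>"
    if \<mu>: "\<mu> \<in> Meas" for \<mu>
  proof (rule measure_eqI)
    show "sets (loop_functional E \<phi> (restrict (loop_sum E \<phi>) Meas) \<mu>) = sets (loop_sum E \<phi> \<mu>)"
      using \<mu> by (simp add: loop_functional_def Meas_def)
    fix S
    have T\<mu>: "?T \<mu> \<in> Meas" using loop_step_funpow_Meas[OF \<phi> \<mu>, of 1 E] by simp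
    have "emeasure (loop_functional E \<phi> (restrict (loop_sum E \<phi>) Meas) \<mu>) S
        = emeasure (loop_exit E \<mu>) S + (\<Sum>n. emeasure (loop_exit E ((?T ^^ Suc n) \<mu>)) S)"
      using T\<mu> \<mu> \<phi>
      by (subst emeasure_loop_functional)
        (auto simp: emeasure_loop_sum Meas_def funpow_Suc_right simp del: funpow.simps)
    also have "\<dots> = (\<Sum>n. emeasure (loop_exit E ((?T ^^ n) \<mu>)) S)"
      using sums_Suc[OF summable_sums[OF summableI], of "\<lambda>n. emeasure (loop_exit E ((?T ^^ n) \<mu>)) S"]
      by (simp add: sums_iff add.commute)
    also have "\<dots> = emeasure (loop_sum E \<phi> \<mu>) S" by (simp add: emeasure_loop_sum \<phi> \<mu>)
    finally show "emeasure (loop_functional E \<phi> (restrict (loop_sum E \<phi>) Meas) \<mu>) S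
        = emeasure (loop_sum E \<phi> \<mu>) S" .
  qed
  then show "restrict (loop_sum E \<phi>) Meas \<in> Meas \<rightarrow>\<^sub>E Meas \<and>
    (\<forall>\<mu>\<in>Meas. loop_functional E \<phi> (restrict (loop_sum E \<phi>) Meas) \<mu>
      = restrict (loop_sum E \<phi>) Meas \<mu>)"
    by (auto simp: Meas_def)
next
  let ?T = "loop_step E \<phi>"
  fix \<psi> :: "'n state measure \<Rightarrow> 'n state measure"
  assume "\<psi> \<in> Meas \<rightarrow>\<^sub>E Meas \<and> (\<forall>\<mu>\<in>Meas. loop_functional E \<phi> \<psi> \<mu> = \<psi> \<mu>)"
  then have \<psi>: "\<psi> \<in> Meas \<rightarrow>\<^sub>E Meas" "\<And>\<mu>. \<mu> \<in> Meas \<Longrightarrow> loop_functional E \<phi> \<psi> \<mu> = \<psi> \<mu>" by auto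
  have "loop_sum E \<phi> \<mu> \<le> \<psi> \<mu>" if \<mu>: "\<mu> \<in> Meas" for \<mu>
  proof -
    have \<psi>\<mu>: "sets (\<psi> \<mu>) = UNIV" using \<psi>(1) \<mu> by (auto simp: Meas_def PiE_iff)
    have "emeasure (loop_sum E \<phi> \<mu>) S \<le> emeasure (\<psi> \<mu>) S" for S
    proof -
      have split: "(\<Sum>n<N. emeasure (loop_exit E ((?T ^^ n) \<mu>)) S) + emeasure (\<psi> ((?T ^^ N) \<mu>)) S
          = emeasure (\<psi> \<mu>) S" for N
      proof (induction N)
        case (Suc N)
        have "(?T ^^ N) \<mu> \<in> Meas" by (rule loop_step_funpow_Meas[OF \<phi> \<mu>])
        then have "emeasure (\<psi> ((?T ^^ N) \<mu>)) S = emeasure (loop_exit E ((?T ^^ N) \<mu>)) S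
            + emeasure (\<psi> ((?T ^^ Suc N) \<mu>)) S"
          using \<psi> emeasure_loop_functional[of \<phi> \<psi> "(?T ^^ N) \<mu>" E S] \<phi> by (auto simp: PiE_iff)
        with Suc show ?case by (simp add: add.assoc)
      qed simp
      have "(\<Sum>n<N. emeasure (loop_exit E ((?T ^^ n) \<mu>)) S) \<le> emeasure (\<psi> \<mu>) S" for N
        unfolding split[of N, symmetric] by simp
      then show ?thesis
        by (simp add: emeasure_loop_sum \<phi> \<mu> suminf_le_const)
    qed
    then show ?thesis using \<psi>\<mu> by (subst le_measure) auto
  qed
  \<comment> \<open>Outside \<open>Meas\<close> both functions are \<open>undefined\<close> by
    extensionality, so there the pointwise order holds by reflexivity.\<close>
  with \<psi>(1) show "restrict (loop_sum E \<phi>) Meas \<le> \<psi>"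
    by (auto simp: le_fun_def PiE_iff extensional_def)
qed

section \<open>Programs\<close>

lemma sem_with_Meas:
  assumes "\<And>E \<phi>. \<phi> \<in> Meas \<rightarrow> Meas \<Longrightarrow> W E \<phi> \<in> Meas \<rightarrow> Meas"
  shows "sem_with W P \<in> Meas \<rightarrow> Meas"
proof (induction P)
  case (While E P)
  then show ?case using assms by simp
qed (auto simp: Meas_def Pi_iff)

lemma sem_Meas: "sem P \<in> Meas \<rightarrow> Meas"
  unfolding sem_def by (rule sem_with_Meas) (auto simp: loop_lfp_eq Meas_def)

lemma sem_lo_Meas: "sem_lo P \<in> Meas \<rightarrow> Meas"
  unfolding sem_lo_def by (rule sem_with_Meas) (auto simp: Meas_def)

lemma sets_sem [simp]: "sets \<mu> = UNIV \<Longrightarrow> sets (sem P \<mu>) = UNIV"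
  using sem_Meas[of P] by (auto simp: Meas_def)

lemma sets_sem_lo [simp]: "sets \<mu> = UNIV \<Longrightarrow> sets (sem_lo P \<mu>) = UNIV"
  using sem_lo_Meas[of P] by (auto simp: Meas_def)

lemma sem_simps [simp]:
  "sem Skip \<mu> = \<mu>"
  "sem (Seq P Q) \<mu> = sem Q (sem P \<mu>)"
  "sem (Reset k) = push (\<lambda>x. x(k := 0))"
  "sem (Incr k a) = push (\<lambda>x. x(k := x k + a))"
  "sem (Decr k) = push (\<lambda>x. x(k := x k - 1))"
  "sem (Cond E P Q) \<mu> = add_measure (restr \<mu> {\<dagger>})
     (add_measure (sem P (event_sem E \<mu>)) (sem Q (event_sem (Neg E) \<mu>)))"
  "sem Fail \<mu> = scale_measure (emeasure \<mu> UNIV) (return (count_space UNIV) \<dagger>)"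
  by (simp_all add: sem_def)

lemma sem_While: "\<mu> \<in> Meas \<Longrightarrow> sem (While E P) \<mu> = loop_sum E (sem P) \<mu>"
  using loop_lfp_eq[OF sem_Meas, of E P] by (simp add: sem_def)

lemma sem_lo_simps [simp]:
  "sem_lo Skip \<mu> = \<mu>"
  "sem_lo (Seq P Q) \<mu> = sem_lo Q (sem_lo P \<mu>)"
  "sem_lo (Reset k) = push (\<lambda>x. x(k := 0))"
  "sem_lo (Incr k a) = push (\<lambda>x. x(k := x k + a))"
  "sem_lo (Decr k) = push (\<lambda>x. x(k := x k - 1))"
  "sem_lo (Cond E P Q) \<mu> = add_measure (restr \<mu> {\<dagger>})
     (add_measure (sem_lo P (event_sem E \<mu>)) (sem_lo Q (event_sem (Neg E) \<mu>)))"
  "sem_lo (While E P) \<mu> = null_measure \<mu>"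
  "sem_lo Fail \<mu> = scale_measure (emeasure \<mu> UNIV) (return (count_space UNIV) \<dagger>)"
  by (simp_all add: sem_lo_def)

section \<open>Mass bounds for the standard semantics\<close>

lemma emeasure_push_UNIV: "sets \<mu> = UNIV \<Longrightarrow> emeasure (push f \<mu>) UNIV = emeasure \<mu> UNIV"
  unfolding push_def by (subst emeasure_distr) (auto simp: measurable_def space_UNIV)

text \<open>This is the mass balance at a guard, used for conditionals and for a single round of a
  loop.\<close>

lemma emeasure_split_dagger:
  assumes "finite_measure \<mu>" "sets \<mu> = UNIV"
  shows "emeasure \<mu> {\<dagger>} + (emeasure (event_sem E \<mu>) UNIV + emeasure (event_sem (Neg E) \<mu>) UNIV)
    = emeasure \<mu> UNIV"
proof -
  have "emeasure \<mu> {\<dagger>} + emeasure \<mu> proper = emeasure \<mu> ({\<dagger>} \<union> proper)"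
    by (rule plus_emeasure) (use assms in auto)
  also have "{\<dagger>} \<union> proper = UNIV" using option.exhaust by (auto simp: image_iff)
  finally show ?thesis using emeasure_event_split[OF assms, of E UNIV] by simp
qed

text \<open>No program creates mass. Hence all intermediate measures stay finite, and the formulas
  for events remain applicable to them.\<close>

lemma emeasure_sem_UNIV_le:
  assumes "finite_measure \<mu>" "sets \<mu> = UNIV"
  shows "emeasure (sem P \<mu>) UNIV \<le> emeasure \<mu> UNIV"
  using assms
proof (induction P arbitrary: \<mu>)
  case (Seq P Q)
  have "finite_measure (sem P \<mu>)"
    using Seq by (intro finite_measure_dominated[OF Seq.prems(1)]) auto
  then have "emeasure (sem Q (sem P \<mu>)) UNIV \<le> emeasure (sem P \<mu>) UNIV" using Seq by simp
  also have "\<dots> \<le> emeasure \<mu> UNIV" using Seq by simp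
  finally show ?case by simp
next
  case (Cond E P Q)
  have "emeasure (sem (Cond E P Q) \<mu>) UNIV = emeasure \<mu> {\<dagger>}
      + (emeasure (sem P (event_sem E \<mu>)) UNIV + emeasure (sem Q (event_sem (Neg E) \<mu>)) UNIV)"
    using Cond.prems
    by (simp add: emeasure_add_measure emeasure_restr del: event_sem.simps)
  also have "\<dots> \<le> emeasure \<mu> {\<dagger>}
      + (emeasure (event_sem E \<mu>) UNIV + emeasure (event_sem (Neg E) \<mu>) UNIV)"
    using Cond.prems
    by (intro add_mono order_refl Cond.IH finite_measure_event_sem) (auto simp del: event_sem.simps)
  finally show ?case by (simp only: emeasure_split_dagger[OF Cond.prems])
next
  case (While E P)
  let ?T = "loop_step E (sem P)"
  have \<mu>: "\<mu> \<in> Meas" using While by (simp add: Meas_def)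
  \<comment> \<open>The invariant adds the mass that has left during the first \<open>N\<close>
    rounds to the mass still inside the loop. Finiteness is carried along because the mass balance
    at the guard and the hypothesis for the body require it.\<close>
  have "(\<Sum>n<N. emeasure (loop_exit E ((?T ^^ n) \<mu>)) UNIV) + emeasure ((?T ^^ N) \<mu>) UNIV
      \<le> emeasure \<mu> UNIV \<and> finite_measure ((?T ^^ N) \<mu>)" for N
  proof (induction N)
    case (Suc N)
    define \<nu> where "\<nu> = (?T ^^ N) \<mu>"
    have \<nu>: "finite_measure \<nu>" "sets \<nu> = UNIV"
      using Suc loop_step_funpow_Meas[OF sem_Meas \<mu>] by (auto simp: \<nu>_def Meas_def)
    have T: "emeasure (?T \<nu>) UNIV \<le> emeasure (event_sem E \<nu>) UNIV"
      unfolding loop_step_def using \<nu> by (intro While.IH finite_measure_event_sem) auto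
    then have "emeasure (loop_exit E \<nu>) UNIV + emeasure (?T \<nu>) UNIV \<le> emeasure \<nu> UNIV"
      unfolding emeasure_split_dagger[OF \<nu>, of E, symmetric] emeasure_loop_exit[OF \<nu>(2)]
      by (simp add: add.assoc add.commute add_left_mono del: event_sem.simps)
    then have "(\<Sum>n<Suc N. emeasure (loop_exit E ((?T ^^ n) \<mu>)) UNIV) + emeasure (?T \<nu>) UNIV
        \<le> (\<Sum>n<N. emeasure (loop_exit E ((?T ^^ n) \<mu>)) UNIV) + emeasure \<nu> UNIV"
      by (simp add: \<nu>_def add.assoc add_left_mono)
    also have "\<dots> \<le> emeasure \<mu> UNIV" using Suc by (simp add: \<nu>_def)
    finally have "(\<Sum>n<Suc N. emeasure (loop_exit E ((?T ^^ n) \<mu>)) UNIV) + emeasure (?T \<nu>) UNIV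
        \<le> emeasure \<mu> UNIV" .
    moreover have "finite_measure (?T \<nu>)"
      using finite_measure_event_sem[OF \<nu>, of E] T \<nu>(2)
      by (rule_tac finite_measure_dominated) (auto simp: loop_step_def)
    ultimately show ?case by (simp add: \<nu>_def)
  qed (use While in simp)
  then have "(\<Sum>n<N. emeasure (loop_exit E ((?T ^^ n) \<mu>)) UNIV) \<le> emeasure \<mu> UNIV" for N
    by (meson le_iff_add order_trans)
  then show ?case
    using \<mu> by (simp add: sem_While emeasure_loop_sum sem_Meas suminf_le_const)
qed (auto simp: emeasure_push_UNIV)

lemma finite_measure_sem:
  "finite_measure \<mu> \<Longrightarrow> sets \<mu> = UNIV \<Longrightarrow> finite_measure (sem P \<mu>)"
  using emeasure_sem_UNIV_le finite_measure_dominated by (metis sets_sem)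

text \<open>Each of the \<open>m\<close> unrollings tests the guard once and contributes one exit
  term, for \<open>n = 0\<close> up to \<open>m - 1\<close>. The loop left at the end has the zero
  measure as its lower bound, so there is no remainder. The measure varies in the induction since
  the first unrolling hands \<open>T \<mu>\<close> to the others.\<close>

lemma emeasure_sem_lo_unroll_loop:
  assumes "\<mu> \<in> Meas"
  shows "emeasure (sem_lo (unroll_loop E Q m) \<mu>) S
    = (\<Sum>n<m. emeasure (loop_exit E ((loop_step E (sem_lo Q) ^^ n) \<mu>)) S)"
  using assms
proof (induction m arbitrary: \<mu>)
  case (Suc m)
  let ?T = "loop_step E (sem_lo Q)"
  have T: "?T \<mu> \<in> Meas" using loop_step_funpow_Meas[OF sem_lo_Meas Suc.prems, of 1 E Q] by simp
  have \<mu>: "sets \<mu> = UNIV" using Suc.prems by (simp add: Meas_def)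
  have "emeasure (sem_lo (unroll_loop E Q (Suc m)) \<mu>) S
      = emeasure (loop_exit E \<mu>) S + emeasure (sem_lo (unroll_loop E Q m) (?T \<mu>)) S"
    using \<mu> by (simp add: emeasure_add_measure emeasure_restr emeasure_loop_exit loop_step_def
        add.assoc add.commute del: event_sem.simps)
  also have "\<dots> = (\<Sum>n<Suc m. emeasure (loop_exit E ((?T ^^ n) \<mu>)) S)"
    by (simp add: Suc.IH[OF T] sum.lessThan_Suc_shift funpow_Suc_right del: funpow.simps(2) sum.lessThan_Suc)
  finally show ?case .
qed simp

section \<open>Increasing convergence\<close>

text \<open>Finiteness is asked of the limit alone; the members of the sequence inherit it by
  domination.\<close>

definition increases_to :: "(nat \<Rightarrow> 'a measure) \<Rightarrow> 'a measure \<Rightarrow> bool" where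
  "increases_to M \<mu> \<longleftrightarrow> (\<forall>u. sets (M u) = UNIV) \<and> sets \<mu> = UNIV \<and> finite_measure \<mu> \<and>
    (\<forall>S. incseq (\<lambda>u. emeasure (M u) S) \<and> (\<lambda>u. emeasure (M u) S) \<longlonglongrightarrow> emeasure \<mu> S)"

lemma increases_toI:
  assumes "\<And>u. sets (M u) = UNIV" "sets \<mu> = UNIV" "finite_measure \<mu>"
    "\<And>S. incseq (\<lambda>u. emeasure (M u) S)" "\<And>S. (\<lambda>u. emeasure (M u) S) \<longlonglongrightarrow> emeasure \<mu> S"
  shows "increases_to M \<mu>"
  using assms by (simp add: increases_to_def)

lemma increases_toD:
  assumes "increases_to M \<mu>"
  shows "sets (M u) = UNIV" "sets \<mu> = UNIV" "finite_measure \<mu>" "incseq (\<lambda>u. emeasure (M u) S)"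
    "(\<lambda>u. emeasure (M u) S) \<longlonglongrightarrow> emeasure \<mu> S" "emeasure (M u) S \<le> emeasure \<mu> S"
    "finite_measure (M u)"
proof -
  show *: "sets (M u) = UNIV" "sets \<mu> = UNIV" "finite_measure \<mu>" "incseq (\<lambda>u. emeasure (M u) S)"
    "(\<lambda>u. emeasure (M u) S) \<longlonglongrightarrow> emeasure \<mu> S" for u S
    using assms by (simp_all add: increases_to_def)
  show le: "emeasure (M u) S \<le> emeasure \<mu> S" for u S
    using incseq_le[OF *(4) *(5)] .
  show "finite_measure (M u)"
    by (rule finite_measure_dominated[OF *(3) *(1) *(2) le])
qed

section \<open>Closure properties of increasing convergence\<close>

lemma increases_to_add:
  assumes M: "increases_to M \<mu>" and N: "increases_to N \<nu>"
  shows "increases_to (\<lambda>u. add_measure (M u) (N u)) (add_measure \<mu> \<nu>)"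
proof (rule increases_toI)
  note M = increases_toD[OF M] and N = increases_toD[OF N]
  show "finite_measure (add_measure \<mu> \<nu>)"
    using M(2,3) N(2,3)
    by (intro finite_measure_UNIV_I)
      (auto simp: emeasure_add_measure finite_measure.emeasure_finite less_top[symmetric])
  show "incseq (\<lambda>u. emeasure (add_measure (M u) (N u)) S)" for S
    using M(4)[of S] N(4)[of S] by (simp add: emeasure_add_measure M(1) N(1) incseq_def add_mono)
  show "(\<lambda>u. emeasure (add_measure (M u) (N u)) S) \<longlonglongrightarrow> emeasure (add_measure \<mu> \<nu>) S" for S
    using tendsto_add[OF M(5) N(5), of S S] by (simp add: emeasure_add_measure M N)
qed (auto simp: increases_toD[OF M])

lemma increases_to_restr:
  assumes "increases_to M \<mu>"
  shows "increases_to (\<lambda>u. restr (M u) A) (restr \<mu> A)"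
  using increases_toD[OF assms]
  by (intro increases_toI) (auto simp: emeasure_restr intro: finite_measure_restr)

lemma increases_to_scale:
  assumes "increases_to M \<mu>" "c < \<infinity>"
  shows "increases_to (\<lambda>u. scale_measure c (M u)) (scale_measure c \<mu>)"
proof (rule increases_toI)
  note M = increases_toD[OF assms(1)]
  show "finite_measure (scale_measure c \<mu>)"
    using M(2,3) assms(2)
    by (intro finite_measure_UNIV_I)
      (auto simp: ennreal_mult_eq_top_iff finite_measure.emeasure_finite less_top[symmetric])
  show "incseq (\<lambda>u. emeasure (scale_measure c (M u)) S)" for S
    using M(4)[of S] by (auto simp: incseq_def intro: mult_left_mono)
  show "(\<lambda>u. emeasure (scale_measure c (M u)) S) \<longlonglongrightarrow> emeasure (scale_measure c \<mu>) S" for S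
    using ennreal_tendsto_cmult[OF _ M(5)] assms(2) by simp
qed (auto simp: increases_toD[OF assms(1)])

lemma increases_to_push:
  fixes M :: "nat \<Rightarrow> 'n state measure"
  assumes "increases_to M \<mu>"
  shows "increases_to (\<lambda>u. push f (M u)) (push f \<mu>)"
proof (rule increases_toI)
  note M = increases_toD[OF assms]
  have *: "emeasure (push f \<nu>) S = emeasure \<nu> (map_option f -` S)"
    if "sets \<nu> = UNIV" for \<nu> :: "'n state measure" and S
    unfolding push_def using that by (subst emeasure_distr) (auto simp: measurable_def space_UNIV)
  show "finite_measure (push f \<mu>)"
    by (rule finite_measure_dominated[OF M(3) _ M(2)]) (simp_all add: emeasure_push_UNIV M(2))
  show "incseq (\<lambda>u. emeasure (push f (M u)) S)" for S using M(4) by (simp add: * M)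
  show "(\<lambda>u. emeasure (push f (M u)) S) \<longlonglongrightarrow> emeasure (push f \<mu>) S" for S
    using M(5) by (simp add: * M)
qed auto

text \<open>An event and its negation go through one induction. For \<open>Neg\<close> the two
  halves of the hypothesis change places, up to a double negation. For \<open>Conj\<close> the
  hypothesis for \<open>E2\<close> is used on the sequence already filtered by \<open>E1\<close>,
  and the negation is a sum of two convergent parts.\<close>

lemma increases_to_event_sem:
  assumes "increases_to M \<mu>"
  shows "increases_to (\<lambda>u. event_sem E (M u)) (event_sem E \<mu>) \<and>
    increases_to (\<lambda>u. event_sem (Neg E) (M u)) (event_sem (Neg E) \<mu>)"
  using assms
proof (induction E arbitrary: M \<mu>)
  case (VarEq k a)
  note M = increases_toD[OF VarEq]
  show ?case
    by (simp only: event_sem_Neg_VarEq[OF M(7) M(1)] event_sem_Neg_VarEq[OF M(3) M(2)])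
      (simp add: increases_to_restr VarEq)
next
  case (Flip r)
  note M = increases_toD[OF Flip]
  show ?case
    by (simp only: event_sem_Neg_Flip[OF M(7) M(1)] event_sem_Neg_Flip[OF M(3) M(2)])
      (simp add: increases_to_restr increases_to_scale Flip)
next
  case (Neg E)
  note M = increases_toD[OF Neg.prems]
  show ?case
    using Neg.IH[OF Neg.prems]
    by (simp only: event_sem_Neg_Neg[OF M(7) M(1)] event_sem_Neg_Neg[OF M(3) M(2)])
next
  case (Conj E1 E2)
  note M = increases_toD[OF Conj.prems]
  note 1 = Conj.IH(1)[OF Conj.prems]
  note 2 = Conj.IH(2)[OF 1[THEN conjunct1]]
  have "increases_to (\<lambda>u. event_sem (Neg (Conj E1 E2)) (M u)) (event_sem (Neg (Conj E1 E2)) \<mu>)"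
    unfolding event_sem_Neg_Conj[OF M(7) M(1)] event_sem_Neg_Conj[OF M(3) M(2)]
    by (rule increases_to_add) (use 1 2 in auto)
  with 2 show ?case by simp
qed

lemmas increases_to_event = increases_to_event_sem[THEN conjunct1]

lemma increases_to_loop_exit:
  assumes "increases_to M \<mu>"
  shows "increases_to (\<lambda>u. loop_exit E (M u)) (loop_exit E \<mu>)"
  unfolding loop_exit_def by (intro increases_to_add increases_to_restr increases_to_event assms)

text \<open>The varying input also serves loops: as \<open>u\<close> grows, the body itself is
  unrolled further, so every iterate of the loop changes along with the number of rounds.\<close>

lemma increases_to_sem_lo_unroll:
  assumes "increases_to M \<mu>"
  shows "increases_to (\<lambda>u. sem_lo (unroll u P) (M u)) (sem P \<mu>)"
  using assms
proof (induction P arbitrary: M \<mu>)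
  case (Cond E P Q)
  then show ?case
    unfolding unroll.simps sem_lo_simps sem_simps
    by (intro increases_to_add increases_to_restr Cond.IH increases_to_event)
next
  case Fail
  note M = increases_toD[OF Fail]
  show ?case
  proof (rule increases_toI)
    show "finite_measure (sem Fail \<mu>)" using M(2,3) by (rule_tac finite_measure_sem)
    \<comment> \<open>On \<open>S\<close> the output is the total input mass times the indicator of
      \<dagger> in \<open>S\<close>, so both remaining claims reduce to the input on
      \<open>UNIV\<close>.\<close>
    show "incseq (\<lambda>u. emeasure (sem_lo (unroll u Fail) (M u)) S)" for S
      using M(4)[of UNIV] by (auto simp: incseq_def intro: mult_right_mono)
    show "(\<lambda>u. emeasure (sem_lo (unroll u Fail) (M u)) S) \<longlonglongrightarrow> emeasure (sem Fail \<mu>) S" for S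
      using ennreal_tendsto_cmult[OF _ M(5)[of UNIV], of "indicator S \<dagger>"]
      by (cases "\<dagger> \<in> S") (simp_all add: M(5))
  qed auto
next
  case (While E P)
  let ?T = "loop_step E (sem P)" and ?Tu = "\<lambda>u. loop_step E (sem_lo (unroll u P))"
  note M = increases_toD[OF While.prems]
  have Meas: "\<mu> \<in> Meas" "M u \<in> Meas" for u using M by (auto simp: Meas_def)
  have "increases_to (\<lambda>u. (?Tu u ^^ n) (M u)) ((?T ^^ n) \<mu>)" for n
  proof (induction n)
    case (Suc n)
    then show ?case
      by (simp add: loop_step_def) (intro While.IH increases_to_event)
  qed (simp add: While.prems)
  then have iter: "increases_to (\<lambda>u. loop_exit E ((?Tu u ^^ n) (M u))) (loop_exit E ((?T ^^ n) \<mu>))"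
    for n by (rule increases_to_loop_exit)
  show ?case
  proof (rule increases_toI)
    show "finite_measure (sem (While E P) \<mu>)" using M(2,3) by (rule_tac finite_measure_sem)
    fix S
    \<comment> \<open>Padding the partial sum by zeros makes it a full series. A padded term still
      increases with \<open>u\<close>, so the growth of the terms and of their number is handled by
      a single exchange of series and supremum.\<close>
    define b where "b u n = (if n < u then emeasure (loop_exit E ((?Tu u ^^ n) (M u))) S else 0)"
      for u n
    have b_inc: "incseq (\<lambda>u. b u n)" for n
      using increases_toD(4)[OF iter, of n S] by (auto simp: incseq_def b_def)
    have lo: "emeasure (sem_lo (unroll u (While E P)) (M u)) S = (\<Sum>n. b u n)" for u
    proof -
      have "(\<Sum>n. b u n) = (\<Sum>n<u. b u n)" by (rule suminf_finite) (auto simp: b_def)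
      then show ?thesis by (simp add: emeasure_sem_lo_unroll_loop Meas b_def)
    qed
    show inc: "incseq (\<lambda>u. emeasure (sem_lo (unroll u (While E P)) (M u)) S)"
      unfolding lo using b_inc by (auto simp: incseq_def intro!: suminf_le)
    \<comment> \<open>For fixed \<open>n\<close> the padding is inactive as soon as
      \<open>u > n\<close>, so it does not affect the limit, which for an increasing sequence is the
      supremum.\<close>
    have "(SUP u. b u n) = emeasure (loop_exit E ((?T ^^ n) \<mu>)) S" for n
    proof (rule LIMSEQ_unique[OF LIMSEQ_SUP[OF b_inc]])
      have "eventually (\<lambda>u. emeasure (loop_exit E ((?Tu u ^^ n) (M u))) S = b u n) sequentially"
        using eventually_gt_at_top[of n] by eventually_elim (simp add: b_def)
      then show "(\<lambda>u. b u n) \<longlonglongrightarrow> emeasure (loop_exit E ((?T ^^ n) \<mu>)) S"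
        using increases_toD(5)[OF iter] by (rule Lim_transform_eventually[rotated])
    qed
    then have "emeasure (sem (While E P) \<mu>) S = (\<Sum>n. SUP u. b u n)"
      by (simp add: sem_While emeasure_loop_sum sem_Meas Meas)
    also have "\<dots> = (SUP u. \<Sum>n. b u n)" by (rule ennreal_suminf_SUP_eq[OF b_inc])
    finally show "(\<lambda>u. emeasure (sem_lo (unroll u (While E P)) (M u)) S)
        \<longlonglongrightarrow> emeasure (sem (While E P) \<mu>) S"
      using LIMSEQ_SUP[OF inc] unfolding lo by simp
  qed (use M in auto)
qed (auto intro: increases_to_push)

section \<open>Posterior probabilities\<close>

text \<open>Since \<open>S\<close> avoids the failure state, removing
  \<open>restr \<nu> {\<dagger>}\<close> changes nothing on \<open>S\<close>. The denominator is
  positive, so the extended quotient is the real one.\<close>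

lemma measure_normalize_sub:
  assumes fin: "finite_measure \<nu>" and sets: "sets \<nu> = UNIV"
    and lt: "emeasure \<nu> {\<dagger>} < 1" and S: "S \<subseteq> proper"
  shows "measure (normalize_sub \<nu>) S = measure \<nu> S / (1 - measure \<nu> {\<dagger>})"
proof -
  interpret finite_measure \<nu> by fact
  have lt': "measure \<nu> {\<dagger>} < 1" using lt by (simp add: emeasure_eq_measure)
  have "S \<inter> {\<dagger>} = {}" using S by auto
  then have diff: "emeasure (diff_measure \<nu> (restr \<nu> {\<dagger>})) S = emeasure \<nu> S"
    by (subst emeasure_diff_measure)
      (auto simp: fin sets emeasure_restr finite_measure_restr intro!: emeasure_mono)
  have "emeasure (normalize_sub \<nu>) S
      = (1 / (1 - emeasure \<nu> {\<dagger>})) * emeasure (diff_measure \<nu> (restr \<nu> {\<dagger>})) S"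
    unfolding normalize_sub_def using S sets
    by (subst emeasure_restrict_space) auto
  also have "\<dots> = ennreal (measure \<nu> S / (1 - measure \<nu> {\<dagger>}))"
    unfolding diff using lt'
    by (simp add: emeasure_eq_measure ennreal_minus divide_ennreal ennreal_mult[symmetric]
        flip: ennreal_1)
  finally show ?thesis using lt' by (simp add: measure_def)
qed

theorem theorem3p5:
  fixes P :: "'n::finite prog" and \<mu> :: "'n state measure"
  assumes "\<mu> \<in> Meas" and "finite_measure \<mu>" and "terminates_as P \<mu>"
  shows "(decseq (\<lambda>u. residual (unroll u P) \<mu>) \<and> (\<lambda>u. residual (unroll u P) \<mu>) \<longlonglongrightarrow> 0) \<and>
    (prob_space \<mu> \<and> emeasure (sem P \<mu>) {\<dagger>} < 1 \<longrightarrow>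
      (\<forall>S\<subseteq>proper.
        (\<lambda>u. measure (sem_lo (unroll u P) \<mu>) S / (1 - measure (sem_lo (unroll u P) \<mu>) {\<dagger>}))
          \<longlonglongrightarrow> measure (normalize_sub (sem P \<mu>)) S \<and>
        (\<lambda>u. (measure (sem_lo (unroll u P) \<mu>) S + residual (unroll u P) \<mu>) /
              (1 - measure (sem_lo (unroll u P) \<mu>) {\<dagger>} - residual (unroll u P) \<mu>))
          \<longlonglongrightarrow> measure (normalize_sub (sem P \<mu>)) S))"
proof -
  define L where "L u = sem_lo (unroll u P) \<mu>" for u
  have sets: "sets \<mu> = UNIV" using assms(1) by (simp add: Meas_def)
  \<comment> \<open>The fixed input is viewed as a constant sequence.\<close>
  have "increases_to (\<lambda>_. \<mu>) \<mu>" using sets assms(2) by (intro increases_toI) auto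
  then have "increases_to L (sem P \<mu>)" unfolding L_def by (rule increases_to_sem_lo_unroll)
  note L = increases_toD[OF this]
  \<comment> \<open>All measures involved are finite, so limits and monotonicity pass from extended
    to real values.\<close>
  have emL: "emeasure (L u) S = ennreal (measure (L u) S)" for u S
    using L(7) by (rule finite_measure.emeasure_eq_measure)
  have emP: "emeasure (sem P \<mu>) S = ennreal (measure (sem P \<mu>) S)" for S
    using L(3) by (rule finite_measure.emeasure_eq_measure)
  have lim: "(\<lambda>u. measure (L u) S) \<longlonglongrightarrow> measure (sem P \<mu>) S" for S
    using L(5)[of S] unfolding emL emP by simp
  have inc: "incseq (\<lambda>u. measure (L u) S)" for S
    using L(4)[of S] unfolding emL by (simp add: incseq_def)
  \<comment> \<open>Almost sure termination replaces the input mass by the mass of the exact output,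
    so the residual becomes the gap between exact and lower bound semantics on
    \<open>UNIV\<close>.\<close>
  have total: "measure (sem P \<mu>) UNIV = measure \<mu> UNIV"
    using assms(3) by (simp add: terminates_as_def measure_def)
  have res: "residual (unroll u P) \<mu> = measure (sem P \<mu>) UNIV - measure (L u) UNIV" for u
    by (simp add: residual_def total L_def)
  have dec: "decseq (\<lambda>u. residual (unroll u P) \<mu>)"
    using inc[of UNIV] by (simp add: res decseq_def incseq_def)
  have res0: "(\<lambda>u. residual (unroll u P) \<mu>) \<longlonglongrightarrow> 0"
    unfolding res using tendsto_diff[OF tendsto_const lim[of UNIV]] by (metis diff_self)
  have "(\<lambda>u. measure (L u) S / (1 - measure (L u) {\<dagger>}))
          \<longlonglongrightarrow> measure (normalize_sub (sem P \<mu>)) S \<and>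
        (\<lambda>u. (measure (L u) S + residual (unroll u P) \<mu>) /
              (1 - measure (L u) {\<dagger>} - residual (unroll u P) \<mu>))
          \<longlonglongrightarrow> measure (normalize_sub (sem P \<mu>)) S"
    if lt: "emeasure (sem P \<mu>) {\<dagger>} < 1" and S: "S \<subseteq> proper" for S
  proof -
    \<comment> \<open>Both denominators tend to this nonzero number, and the vanishing residual
      gives both numerators the same limit. For small \<open>u\<close> the second denominator may be
      \<open>0\<close>, where division returns the default \<open>0\<close>; the limit is
      unaffected.\<close>
    have "1 - measure (sem P \<mu>) {\<dagger>} \<noteq> 0" using lt by (simp add: emP)
    then show ?thesis
      unfolding measure_normalize_sub[OF L(3) L(2) lt S]
      by (auto intro!: tendsto_eq_intros lim res0)
  qed
  then show ?thesis using dec res0 by (simp add: L_def)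
qed

end
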